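(* Let $S = \{ n \in \mathbb{N} \mid \exists\, x \in \mathbb{N} : x^2 \equiv n \pmod 7 \}$. Then the minimal set of $S$ is $$M(S) = \{ 1,2,4,7,8,9,30,35,36,50,53,56,60,63,65,333,555,666 \}.$$
   Context: $\mathbb{N}=\{1,2,3,\ldots\}$ denotes the positive integers. Each positive integer is identified with its usual base-10 digit string (without leading zeros). For positive integers $x,y$ write $x \triangleleft y$ if the digit string of $x$ is a subsequence (in order, not necessarily contiguous) of the digit string of $y$, i.e. either $x=y$ or $x$ is obtained from $y$ by deleting some digits of $y$ (for example $514 \triangleleft 352148$). For a set $S\subset\mathbb{N}$, the minimal set of $S$ is $$M(S) := \{ s\in S \mid \{ n\in S : n<s,\ n\triangleleft s\}=\varnothing \}.$$ *)

theory Defs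
  imports Main "HOL-Library.Sublist" "HOL-Number_Theory.Cong"
begin

(* Most significant digit first; positive numbers get no leading zero, and 0 gets [0]. *)
fun digits :: "nat \<Rightarrow> nat list" where
  "digits n = (if n < 10 then [n] else digits (n div 10) @ [n mod 10])"

declare digits.simps [simp del]

definition digit_subseq :: "nat \<Rightarrow> nat \<Rightarrow> bool" (infix "\<triangleleft>" 50) where
  "x \<triangleleft> y \<longleftrightarrow> subseq (digits x) (digits y)"

definition minimal_set :: "nat set \<Rightarrow> nat set" where
  "minimal_set S = {s \<in> S. {n \<in> S. n < s \<and> n \<triangleleft> s} = {}}"

lemma foldl_digits: "foldl (\<lambda>a d. 10 * a + d) 0 (digits n) = n"
  by (induction n rule: digits.induct) (subst digits.simps, simp)

lemma "514 \<triangleleft> 352148"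
  by (simp add: digit_subseq_def digits.simps)

end

(* Every element of S contains one of the listed numbers: a digit string without 1, 2, 4, 7, 8, 9
   starts with some h in {3, 5, 6}; a later digit different from h yields one of the two-digit
   numbers, and otherwise the string is a repdigit, which is not in S unless it contains hhh.
   The listed numbers form an antichain, so they are exactly the minimal elements. *)
theory Submission
  imports Defs
begin

text \<open>Two accumulators make the induction work: a matched digit preserves
  \<open>a \<le> b\<close>, and a skipped digit \<open>y\<close> only replaces \<open>b\<close> by
  \<open>10 * b + y\<close>, which is at least \<open>b\<close>.\<close>

lemma subseq_foldl_le:
  fixes xs ys :: "nat list"
  assumes "subseq xs ys" "a \<le> b"
  shows "foldl (\<lambda>a d. 10 * a + d) a xs \<le> foldl (\<lambda>a d. 10 * a + d) b ys"
  using assms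
proof (induction xs ys arbitrary: a b rule: list_emb.induct)
  case (list_emb_Nil ys)
  then show ?case
  proof (induction ys arbitrary: b)
    case (Cons y ys)
    from Cons.prems have "a \<le> 10 * b + y" by simp
    from Cons.IH[OF this] show ?case by simp
  qed simp
qed simp_all

lemma digit_subseq_imp_le: "m \<triangleleft> n \<Longrightarrow> m \<le> n"
  unfolding digit_subseq_def
  using subseq_foldl_le[of "digits m" "digits n" 0 0] by (simp add: foldl_digits)

lemma digit_subseq_trans: "k \<triangleleft> m \<Longrightarrow> m \<triangleleft> n \<Longrightarrow> k \<triangleleft> n"
  unfolding digit_subseq_def by (rule subseq_order.trans)

lemma digit_subseq_antisym: "m \<triangleleft> n \<Longrightarrow> n \<triangleleft> m \<Longrightarrow> m = n"
  by (simp add: digit_subseq_imp_le le_antisym)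

text \<open>A minimal \<open>s\<close> lies above some \<open>m\<close> in \<open>M\<close>, and
  since \<open>\<triangleleft>\<close> implies \<open>\<le>\<close>, minimality forces
  \<open>m = s\<close>. Conversely, an \<open>n\<close> in \<open>S\<close> strictly below
  \<open>m\<close> would lie above some \<open>m'\<close> in \<open>M\<close>; the antichain
  condition gives \<open>m' = m\<close>, hence \<open>n = m\<close> by antisymmetry.\<close>

lemma minimal_set_eqI:
  assumes "M \<subseteq> S"
    and dominated: "\<And>s. s \<in> S \<Longrightarrow> \<exists>m\<in>M. m \<triangleleft> s"
    and antichain: "\<And>m m'. m \<in> M \<Longrightarrow> m' \<in> M \<Longrightarrow> m' \<triangleleft> m \<Longrightarrow> m' = m"
  shows "minimal_set S = M"
proof (intro equalityI subsetI)
  fix s assume s: "s \<in> minimal_set S"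
  then obtain m where m: "m \<in> M" "m \<triangleleft> s"
    using dominated by (auto simp: minimal_set_def)
  then have "\<not> m < s" using s \<open>M \<subseteq> S\<close> by (auto simp: minimal_set_def)
  with m digit_subseq_imp_le[of m s] show "s \<in> M" by simp
next
  fix m assume m: "m \<in> M"
  have "\<not> n \<triangleleft> m" if n: "n \<in> S" "n < m" for n
  proof
    assume nm: "n \<triangleleft> m"
    obtain m' where m': "m' \<in> M" "m' \<triangleleft> n" using dominated n by blast
    then have "m' = m" using antichain[OF m] digit_subseq_trans nm by blast
    then show False using m' nm n digit_subseq_antisym by blast
  qed
  then show "m \<in> minimal_set S" using m \<open>M \<subseteq> S\<close> by (auto simp: minimal_set_def)
qed

lemma digits_less_10: "d \<in> set (digits n) \<Longrightarrow> d < 10"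
proof (induction n rule: digits.induct)
  case (1 n)
  then show ?case by (cases "n < 10") (auto simp: digits.simps[of n])
qed

lemma digits_neq_Nil: "digits n \<noteq> []"
  by (subst digits.simps) simp

lemma hd_digits_pos: "n > 0 \<Longrightarrow> hd (digits n) > 0"
proof (induction n rule: digits.induct)
  case (1 n)
  then show ?case by (cases "n < 10") (simp_all add: digits.simps[of n] digits_neq_Nil)
qed

lemma square_cong_mod_7_iff:
  "(\<exists>x::nat. x > 0 \<and> [x ^ 2 = n] (mod 7)) \<longleftrightarrow> n mod 7 \<in> {0, 1, 2, 4}"
proof
  assume "\<exists>x::nat. x > 0 \<and> [x ^ 2 = n] (mod 7)"
  then obtain x :: nat where x: "x ^ 2 mod 7 = n mod 7" by (auto simp: cong_def)
  have "x mod 7 = 0 \<or> x mod 7 = 1 \<or> x mod 7 = 2 \<or> x mod 7 = 3 \<or>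
      x mod 7 = 4 \<or> x mod 7 = 5 \<or> x mod 7 = 6"
    by presburger
  then have "(x mod 7) ^ 2 mod 7 \<in> {0, 1, 2, 4}"
    by (elim disjE; simp)
  then show "n mod 7 \<in> {0, 1, 2, 4}" using x by (simp add: power_mod)
next
  assume "n mod 7 \<in> {0, 1, 2, 4}"
  \<comment> \<open>Witnesses for the residues 0, 1, 2, 4 in this order; 7 stands in for 0 because
    \<open>x\<close> has to be positive.\<close>
  then have "[7 ^ 2 = n] (mod 7) \<or> [1 ^ 2 = n] (mod 7) \<or> [3 ^ 2 = n] (mod 7) \<or> [2 ^ 2 = n] (mod 7)"
    by (auto simp: cong_def)
  then show "\<exists>x::nat. x > 0 \<and> [x ^ 2 = n] (mod 7)"
    by (meson zero_less_numeral zero_less_one)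
qed

text \<open>Being expanded on parsing, it lets the lemmas match the explicit set in the theorem
  literally, and its elements are visible to the simplifier without unfolding.\<close>

abbreviation (input) M7 :: "nat set" where
  "M7 \<equiv> {1, 2, 4, 7, 8, 9, 30, 35, 36, 50, 53, 56, 60, 63, 65, 333, 555, 666}"

lemma M7_antichain: "m \<in> M7 \<Longrightarrow> m' \<in> M7 \<Longrightarrow> m' \<triangleleft> m \<Longrightarrow> m' = m"
proof -
  have digits: "digits 1 = [1]" "digits 2 = [2]" "digits 4 = [4]" "digits 7 = [7]"
    "digits 8 = [8]" "digits 9 = [9]" "digits 30 = [3, 0]" "digits 35 = [3, 5]"
    "digits 36 = [3, 6]" "digits 50 = [5, 0]" "digits 53 = [5, 3]" "digits 56 = [5, 6]"
    "digits 60 = [6, 0]" "digits 63 = [6, 3]" "digits 65 = [6, 5]"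
    "digits 333 = [3, 3, 3]" "digits 555 = [5, 5, 5]" "digits 666 = [6, 6, 6]"
    by (simp_all add: digits.simps)
  \<comment> \<open>Expanding both quantifiers over the explicit set leaves finitely many
    \<open>subseq\<close> tests on literal lists.\<close>
  have "\<forall>m\<in>M7. \<forall>m'\<in>M7. subseq (digits m') (digits m) \<longrightarrow> m' = m"
    by (simp only: ball_simps digits) simp
  then show "m \<in> M7 \<Longrightarrow> m' \<in> M7 \<Longrightarrow> m' \<triangleleft> m \<Longrightarrow> m' = m"
    unfolding digit_subseq_def by blast
qed

lemma M7_dominates:
  assumes "n > 0" and res: "n mod 7 \<in> {0, 1, 2, 4}"
  shows "\<exists>m\<in>M7. m \<triangleleft> n"
proof -
  obtain h t where ht: "digits n = h # t" using digits_neq_Nil by (cases "digits n") auto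
  have h0: "h > 0" using hd_digits_pos[OF \<open>n > 0\<close>] ht by simp
  show ?thesis
  proof (cases "\<exists>d\<in>set (digits n). d \<in> {1, 2, 4, 7, 8, 9}")
    case True
    then obtain d where d: "d \<in> set (digits n)" "d \<in> {1, 2, 4, 7, 8, 9}" by blast
    then have "digits d = [d]" by (subst digits.simps) auto
    then have "d \<triangleleft> n" using d by (simp add: digit_subseq_def subseq_singleton_left)
    then show ?thesis using d by blast
  next
    case False
    have dig: "d \<in> {0, 3, 5, 6}" if "d \<in> set (digits n)" for d
    proof -
      have "d \<in> {0, 1, 2, 3, 4, 5, 6, 7, 8, 9}" using digits_less_10[OF that] by auto
      then show ?thesis using False that by auto
    qed
    \<comment> \<open>Only the leading digit is known to be nonzero; 0 may still occur in
      \<open>t\<close>.\<close>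
    have h: "h \<in> {3, 5, 6}" using dig[of h] ht h0 by auto
    show ?thesis
    proof (cases "\<exists>e\<in>set t. e \<noteq> h")
      case True
      then obtain e where e: "e \<in> set t" "e \<noteq> h" by blast
      have e': "e \<in> {0, 3, 5, 6}" using dig[of e] ht e by simp
      have "digits (10 * h + e) = [h, e]"
        using h e' by (elim insertE emptyE; simp add: digits.simps)
      then have "10 * h + e \<triangleleft> n"
        using e ht by (simp add: digit_subseq_def subseq_singleton_left)
      \<comment> \<open>The nine choices of \<open>h\<close> and \<open>e\<close> give exactly the
        two-digit members of \<open>M7\<close>.\<close>
      moreover have "10 * h + e \<in> M7" using h e' e by (elim insertE emptyE; simp)
      ultimately show ?thesis by blast
    next
      case False
      then have t: "t = replicate (length t) h" by (metis replicate_eqI)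
      consider "t = []" | "t = [h]" | k where "t = h # h # replicate k h"
        using t by (cases "length t"; cases "length t - 1") auto
      then show ?thesis
      proof cases
        case 1
        then have "n = h" using foldl_digits[of n] ht by simp
        \<comment> \<open>Contradiction: 3, 5, 6 are the quadratic non-residues modulo 7.\<close>
        then show ?thesis using h res by auto
      next
        case 2
        then have "n = 11 * h" using foldl_digits[of n] ht by simp
        \<comment> \<open>Contradiction again: 11 is congruent to the square 4, so
          \<open>11 * h\<close> remains a non-residue.\<close>
        then show ?thesis using h res by auto
      next
        case 3
        \<comment> \<open>Three copies suffice: 111 is congruent to the non-residue 6, so
          \<open>111 * h\<close> is a residue and is listed in \<open>M7\<close>.\<close>
        have "digits (111 * h) = [h, h, h]"
          using h by (elim insertE emptyE; simp add: digits.simps)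
        then have "111 * h \<triangleleft> n" using 3 ht by (simp add: digit_subseq_def)
        moreover have "111 * h \<in> M7" using h by auto
        ultimately show ?thesis by blast
      qed
    qed
  qed
qed

theorem theorem3:
  fixes S :: "nat set"
  assumes "S = {n. n > 0 \<and> (\<exists>x. x > 0 \<and> [x ^ 2 = n] (mod 7))}"
  shows "minimal_set S =
    {1, 2, 4, 7, 8, 9, 30, 35, 36, 50, 53, 56, 60, 63, 65, 333, 555, 666}"
proof (rule minimal_set_eqI)
  have S: "S = {n. n > 0 \<and> n mod 7 \<in> {0, 1, 2, 4}}"
    unfolding assms square_cong_mod_7_iff by (rule refl)
  show "M7 \<subseteq> S" unfolding S by simp
  show "\<exists>m\<in>M7. m \<triangleleft> s" if "s \<in> S" for s
    using that by (intro M7_dominates) (simp_all only: S mem_Collect_eq)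
qed (rule M7_antichain)

end
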